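(* Let $\widehat d_{ij}$ be the multiscale statistics defined in the context, and suppose that, as $T\to\infty$, \[ \max_{1\le k\le K_0}\max_{i,j\in G_k}\widehat d_{ij}=O_p\big(\sqrt{\log n+\log T}\big) \quad\text{and}\quad \min_{1\le k<k'\le K_0}\min_{i\in G_k,\ j\in G_{k'}}\widehat d_{ij}\ge c_0\sqrt{Th_{\max}}+o_p\big(\sqrt{Th_{\max}}\big) \] for some sufficiently small positive constant $c_0$. Let $\{\pi_{n,T}\}$ be any threshold sequence with \[ \sqrt{\log n+\log T}\ \ll\ \pi_{n,T}\ \ll\ \sqrt{Th_{\max}}, \] where $a_{n,T}\ll b_{n,T}$ means $a_{n,T}=o(b_{n,T})$. Define \[ \widehat K_0=\min\Big\{K=1,2,\ldots\ \Big|\ \max_{1\le k\le K}\widehat\Delta\big(\widehat G_k^{[n-K]}\big)\le\pi_{n,T}\Big\}, \] where $\widehat G_k^{[r]}$ are the clusters of the hierarchical agglomerative clustering algorithm and $\widehat\Delta(S)=\widehat\Delta(S,S)$ (see context). Then $P(\widehat K_0=K_0)\to1$ as $T\to\infty$.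
   Context: **Model.** For each $T$, with $n=n(T)\ge 2$ (bounded or diverging), one observes real random variables $(Y_{it},X_{it})$, $1\le i\le n$, $1\le t\le T$, with $X_{it}\in[0,1]$ and $Y_{it}=m_i(X_{it})+\alpha_i+\gamma_t+\varepsilon_{it}$, where $m_i:[0,1]\to\mathbb R$ are unknown functions, $E[\varepsilon_{it}\mid X_{it}]=0$, and $\alpha_i,\gamma_t$ are (random) fixed effects, allowed to be arbitrarily correlated with the regressors. Normalization: $E[m_i(X_{it})]=0$ for all $i,t$. There is a fixed number $K_0$ of groups: $\{1,\ldots,n\}$ is the disjoint union of non-empty $G_1,\ldots,G_{K_0}$ (which may depend on $n$), and $m_i=g_k$ for all $i\in G_k$, with $g_k\ne g_{k'}$ for $k\ne k'$. **Estimators.** $K$ is a kernel with compact support $[-1,1]$, $K_h(\varphi)=h^{-1}K(\varphi/h)$. Put $\widehat Y^*_{it}=Y_{it}-\overline Y_i-\overline Y_t^{(i)}+\overline{\overline Y}^{(i)}$ with $\overline Y_i=\frac1T\sum_{t=1}^T Y_{it}$, $\overline Y_t^{(i)}=\frac1{n-1}\sum_{j\ne i}Y_{jt}$, $\overline{\overline Y}^{(i)}=\frac1{(n-1)T}\sum_{j\neq i}\sum_{t=1}^T Y_{jt}$. The local linear estimator is $\widehat m_{i,h}(x)=\sum_{t=1}^T W_{it}(x,h)\widehat Y^*_{it}\big/\sum_{t=1}^T W_{it}(x,h)$, with $W_{it}(x,h)=K_h(X_{it}-x)\{S_{i,2}(x,h)-\frac{X_{it}-x}{h}S_{i,1}(x,h)\}$,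 $S_{i,\ell}(x,h)=\frac1T\sum_{t=1}^T K_h(X_{it}-x)\big(\frac{X_{it}-x}{h}\big)^\ell$. Let $\kappa_\ell(x,h)=\int_{-x/h}^{(1-x)/h}u^\ell K(u)\,du$, $s(x,h)=\dfrac{\int_{-x/h}^{(1-x)/h}K^2(u)[\kappa_2(x,h)-\kappa_1(x,h)u]^2du}{\{\kappa_0(x,h)\kappa_2(x,h)-\kappa_1(x,h)^2\}^2}$, $\widehat f_{i,h}(x)=\{\kappa_0(x,h)T\}^{-1}\sum_{t=1}^T K_h(X_{it}-x)$, $\widehat\sigma^2_{i,h}(x)=\sum_{t=1}^T K_h(X_{it}-x)[\widehat Y^*_{it}-\widehat m_{i,h}(X_{it})]^2\big/\sum_{t=1}^T K_h(X_{it}-x)$ (which, if the errors $\varepsilon_{it}$ are homoskedastic, may be replaced by $\widehat\sigma^2_{i,h}=\frac1T\sum_{t=1}^T\{\widehat Y^*_{it}-\widehat m_{i,h}(X_{it})\}^2$), $\widehat\nu_{ij}(x,h)=\big\{\widehat\sigma_{i,h}^2(x)/\widehat f_{i,h}(x)+\widehat\sigma_{j,h}^2(x)/\widehat f_{j,h}(x)\big\}s(x,h)$, and $\widehat\psi_{ij}(x,h)=\sqrt{Th}\,\{\widehat m_{i,h}(x)-\widehat m_{j,h}(x)\}/\sqrt{\widehat\nu_{ij}(x,h)}$. **Multiscale statistic.** $\widehat d_{ij}=\max_{(x,h)\in\mathcal G_T}\{|\widehat\psi_{ij}(x,h)|-\lambda(2h)\}$ with $\lambda(r)=\sqrt{2\log(1/r)}$.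 The grid $\mathcal G_T$ is a subset of $\mathcal G=\{(x,h): x\in[0,1],\ h_{\min}\le h\le h_{\max}\}$ that becomes dense in $\mathcal G$ as $T\to\infty$, with $|\mathcal G_T|\le CT^\beta$ for some fixed $C,\beta>0$, and $h_{\min}\ge cT^{-(1-\delta)}$, $h_{\max}\le CT^{-\delta}$ for some small fixed $\delta>0$ and positive constants $c,C$. **Clustering.** For $S,S'\subseteq\{1,\ldots,n\}$, $\widehat\Delta(S,S')=\max_{i\in S,\,j\in S'}\widehat d_{ij}$. HAC algorithm: Step $0$: $\widehat G_i^{[0]}=\{i\}$, $1\le i\le n$. Step $r$ ($r=1,\ldots,n-1$): among the clusters $\widehat G_1^{[r-1]},\ldots,\widehat G_{n-(r-1)}^{[r-1]}$ determine the pair with the smallest dissimilarity $\widehat\Delta$ (over pairs of distinct clusters) and merge it into a new cluster, which gives the partition $\{\widehat G_1^{[r]},\ldots,\widehat G_{n-r}^{[r]}\}$. *)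

theory Defs
  imports "HOL-Probability.Probability" "HOL-Library.Landau_Symbols"
begin

section \<open>Stochastic order symbols\<close>

text \<open>Random variables \<open>Z T\<close> may live on a different probability space \<open>M T\<close> for each \<open>T\<close>.
  Measurability is part of both notions, because \<open>measure\<close> is 0 on non-measurable sets.\<close>

definition bigO_p :: "(nat \<Rightarrow> 'a measure) \<Rightarrow> (nat \<Rightarrow> 'a \<Rightarrow> real) \<Rightarrow> (nat \<Rightarrow> real) \<Rightarrow> bool" where
  "bigO_p M Z b \<longleftrightarrow>
     (\<forall>\<^sub>F T in sequentially. Z T \<in> borel_measurable (M T)) \<and>
     (\<forall>e>0. \<exists>B>0. \<forall>\<^sub>F T in sequentially.
        measure (M T) {\<omega> \<in> space (M T). \<bar>Z T \<omega>\<bar> > B * \<bar>b T\<bar>} < e)"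

definition smallo_p :: "(nat \<Rightarrow> 'a measure) \<Rightarrow> (nat \<Rightarrow> 'a \<Rightarrow> real) \<Rightarrow> (nat \<Rightarrow> real) \<Rightarrow> bool" where
  "smallo_p M Z b \<longleftrightarrow>
     (\<forall>\<^sub>F T in sequentially. Z T \<in> borel_measurable (M T)) \<and>
     (\<forall>e>0. (\<lambda>T. measure (M T) {\<omega> \<in> space (M T). \<bar>Z T \<omega>\<bar> > e * \<bar>b T\<bar>}) \<longlonglongrightarrow> 0)"


section \<open>The panel model with group structure\<close>

definition cond_exp_given :: "'a measure \<Rightarrow> ('a \<Rightarrow> real) \<Rightarrow> ('a \<Rightarrow> real) \<Rightarrow> 'a \<Rightarrow> real" where
  "cond_exp_given N X Z = real_cond_exp N (vimage_algebra (space N) X borel) Z"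

text \<open>Everything observed or unobserved at sample size \<open>T\<close> may depend on \<open>T\<close> (triangular array);
  only the number of groups \<open>K0\<close> and the group functions \<open>g k\<close> are fixed.
  The functions \<open>m T i\<close> and \<open>g k\<close> are only relevant on \<open>{0..1}\<close>.\<close>

locale grouped_panel_model =
  fixes M :: "nat \<Rightarrow> 'a measure"
    and n :: "nat \<Rightarrow> nat"
    and K0 :: nat
    and G :: "nat \<Rightarrow> nat \<Rightarrow> nat set"
    and g :: "nat \<Rightarrow> real \<Rightarrow> real"
    and m :: "nat \<Rightarrow> nat \<Rightarrow> real \<Rightarrow> real"
    and X Y \<epsilon> :: "nat \<Rightarrow> nat \<Rightarrow> nat \<Rightarrow> 'a \<Rightarrow> real"
    and \<alpha> \<gamma> :: "nat \<Rightarrow> nat \<Rightarrow> 'a \<Rightarrow> real"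
  assumes prob_space_M: "\<And>T. T \<ge> 1 \<Longrightarrow> prob_space (M T)"
    and n_ge_2: "\<And>T. T \<ge> 1 \<Longrightarrow> n T \<ge> 2"
    and n_bounded_or_diverging: "(\<exists>B. \<forall>T\<ge>1. n T \<le> B) \<or> filterlim n at_top sequentially"
    and X_measurable: "\<And>T i t. T \<ge> 1 \<Longrightarrow> i \<in> {1..n T} \<Longrightarrow> t \<in> {1..T} \<Longrightarrow>
          X T i t \<in> borel_measurable (M T)"
    and Y_measurable: "\<And>T i t. T \<ge> 1 \<Longrightarrow> i \<in> {1..n T} \<Longrightarrow> t \<in> {1..T} \<Longrightarrow>
          Y T i t \<in> borel_measurable (M T)"
    and \<alpha>_measurable: "\<And>T i. T \<ge> 1 \<Longrightarrow> i \<in> {1..n T} \<Longrightarrow> \<alpha> T i \<in> borel_measurable (M T)"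
    and \<gamma>_measurable: "\<And>T t. T \<ge> 1 \<Longrightarrow> t \<in> {1..T} \<Longrightarrow> \<gamma> T t \<in> borel_measurable (M T)"
    and X_range: "\<And>T i t \<omega>. T \<ge> 1 \<Longrightarrow> i \<in> {1..n T} \<Longrightarrow> t \<in> {1..T} \<Longrightarrow> \<omega> \<in> space (M T) \<Longrightarrow>
          X T i t \<omega> \<in> {0..1}"
    and model_eq: "\<And>T i t \<omega>. T \<ge> 1 \<Longrightarrow> i \<in> {1..n T} \<Longrightarrow> t \<in> {1..T} \<Longrightarrow> \<omega> \<in> space (M T) \<Longrightarrow>
          Y T i t \<omega> = m T i (X T i t \<omega>) + \<alpha> T i \<omega> + \<gamma> T t \<omega> + \<epsilon> T i t \<omega>"
    and \<epsilon>_integrable: "\<And>T i t. T \<ge> 1 \<Longrightarrow> i \<in> {1..n T} \<Longrightarrow> t \<in> {1..T} \<Longrightarrow>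
          integrable (M T) (\<epsilon> T i t)"
    and \<epsilon>_cond_mean: "\<And>T i t. T \<ge> 1 \<Longrightarrow> i \<in> {1..n T} \<Longrightarrow> t \<in> {1..T} \<Longrightarrow>
          AE \<omega> in M T. cond_exp_given (M T) (X T i t) (\<epsilon> T i t) \<omega> = 0"
    and m_integrable: "\<And>T i t. T \<ge> 1 \<Longrightarrow> i \<in> {1..n T} \<Longrightarrow> t \<in> {1..T} \<Longrightarrow>
          integrable (M T) (\<lambda>\<omega>. m T i (X T i t \<omega>))"
    and m_normalized: "\<And>T i t. T \<ge> 1 \<Longrightarrow> i \<in> {1..n T} \<Longrightarrow> t \<in> {1..T} \<Longrightarrow>
          (\<integral>\<omega>. m T i (X T i t \<omega>) \<partial>M T) = 0"
    and groups_union: "\<And>T. T \<ge> 1 \<Longrightarrow> (\<Union>k\<in>{1..K0}. G T k) = {1..n T}"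
    and groups_disjoint: "\<And>T. T \<ge> 1 \<Longrightarrow> disjoint_family_on (G T) {1..K0}"
    and groups_nonempty: "\<And>T k. T \<ge> 1 \<Longrightarrow> k \<in> {1..K0} \<Longrightarrow> G T k \<noteq> {}"
    and m_eq_g: "\<And>T k i x. T \<ge> 1 \<Longrightarrow> k \<in> {1..K0} \<Longrightarrow> i \<in> G T k \<Longrightarrow> x \<in> {0..1} \<Longrightarrow>
          m T i x = g k x"
    and g_distinct: "\<And>k k'. k \<in> {1..K0} \<Longrightarrow> k' \<in> {1..K0} \<Longrightarrow> k \<noteq> k' \<Longrightarrow>
          \<exists>x\<in>{0..1}. g k x \<noteq> g k' x"

definition homoskedastic ::
  "(nat \<Rightarrow> 'a measure) \<Rightarrow> (nat \<Rightarrow> nat) \<Rightarrow> (nat \<Rightarrow> nat \<Rightarrow> nat \<Rightarrow> 'a \<Rightarrow> real) \<Rightarrow>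
   (nat \<Rightarrow> nat \<Rightarrow> nat \<Rightarrow> 'a \<Rightarrow> real) \<Rightarrow> bool" where
  "homoskedastic M n X \<epsilon> \<longleftrightarrow>
     (\<forall>T\<ge>1. \<forall>i\<in>{1..n T}. \<exists>\<sigma>2. \<forall>t\<in>{1..T}.
        integrable (M T) (\<lambda>\<omega>. (\<epsilon> T i t \<omega>)\<^sup>2) \<and>
        (AE \<omega> in M T. cond_exp_given (M T) (X T i t) (\<lambda>\<omega>. (\<epsilon> T i t \<omega>)\<^sup>2) \<omega> = \<sigma>2))"


section \<open>Estimators\<close>

text \<open>The estimators are functions of a realized panel \<open>X, Y\<close>, where \<open>X i t\<close> and \<open>Y i t\<close> are used
  for \<open>1 \<le> i \<le> n\<close> and \<open>1 \<le> t \<le> T\<close>. Quotients with denominator 0 have value 0.\<close>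

type_synonym panel = "nat \<Rightarrow> nat \<Rightarrow> real"

definition smoothing_kernel :: "(real \<Rightarrow> real) \<Rightarrow> bool" where
  "smoothing_kernel K \<longleftrightarrow> K \<in> borel_measurable borel \<and> integrable lborel K \<and> (\<integral>u. K u \<partial>lborel) = 1 \<and>
     (\<forall>u. u \<notin> {-1..1} \<longrightarrow> K u = 0)"

definition K_scaled :: "(real \<Rightarrow> real) \<Rightarrow> real \<Rightarrow> real \<Rightarrow> real" where
  "K_scaled K h \<phi> = K (\<phi> / h) / h"

definition Y_star :: "nat \<Rightarrow> nat \<Rightarrow> panel \<Rightarrow> nat \<Rightarrow> nat \<Rightarrow> real" where
  "Y_star n T Y i t =
     Y i t
     - (\<Sum>s=1..T. Y i s) / real T
     - (\<Sum>j\<in>{1..n} - {i}. Y j t) / (real n - 1)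
     + (\<Sum>j\<in>{1..n} - {i}. \<Sum>s=1..T. Y j s) / ((real n - 1) * real T)"

definition S_loc :: "(real \<Rightarrow> real) \<Rightarrow> nat \<Rightarrow> panel \<Rightarrow> nat \<Rightarrow> nat \<Rightarrow> real \<Rightarrow> real \<Rightarrow> real" where
  "S_loc K T X i l x h = (\<Sum>t=1..T. K_scaled K h (X i t - x) * ((X i t - x) / h) ^ l) / real T"

definition W_loc :: "(real \<Rightarrow> real) \<Rightarrow> nat \<Rightarrow> panel \<Rightarrow> nat \<Rightarrow> nat \<Rightarrow> real \<Rightarrow> real \<Rightarrow> real" where
  "W_loc K T X i t x h =
     K_scaled K h (X i t - x) * (S_loc K T X i 2 x h - (X i t - x) / h * S_loc K T X i 1 x h)"

definition m_hat ::
  "(real \<Rightarrow> real) \<Rightarrow> nat \<Rightarrow> nat \<Rightarrow> panel \<Rightarrow> panel \<Rightarrow> nat \<Rightarrow> real \<Rightarrow> real \<Rightarrow> real" where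
  "m_hat K n T X Y i h x =
     (\<Sum>t=1..T. W_loc K T X i t x h * Y_star n T Y i t) / (\<Sum>t=1..T. W_loc K T X i t x h)"

definition kappa :: "(real \<Rightarrow> real) \<Rightarrow> nat \<Rightarrow> real \<Rightarrow> real \<Rightarrow> real" where
  "kappa K l x h = (LBINT u:{-x/h..(1-x)/h}. u ^ l * K u)"

definition s_const :: "(real \<Rightarrow> real) \<Rightarrow> real \<Rightarrow> real \<Rightarrow> real" where
  "s_const K x h =
     (LBINT u:{-x/h..(1-x)/h}. (K u)\<^sup>2 * (kappa K 2 x h - kappa K 1 x h * u)\<^sup>2)
     / (kappa K 0 x h * kappa K 2 x h - (kappa K 1 x h)\<^sup>2)\<^sup>2"

definition f_hat :: "(real \<Rightarrow> real) \<Rightarrow> nat \<Rightarrow> panel \<Rightarrow> nat \<Rightarrow> real \<Rightarrow> real \<Rightarrow> real" where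
  "f_hat K T X i h x = (\<Sum>t=1..T. K_scaled K h (X i t - x)) / (kappa K 0 x h * real T)"

text \<open>The flag \<open>pooled\<close> selects the variance estimator intended for homoskedastic errors,
  which does not depend on \<open>x\<close>.\<close>

definition sigma2_hat ::
  "bool \<Rightarrow> (real \<Rightarrow> real) \<Rightarrow> nat \<Rightarrow> nat \<Rightarrow> panel \<Rightarrow> panel \<Rightarrow> nat \<Rightarrow> real \<Rightarrow> real \<Rightarrow> real" where
  "sigma2_hat pooled K n T X Y i h x =
     (if pooled then
        (\<Sum>t=1..T. (Y_star n T Y i t - m_hat K n T X Y i h (X i t))\<^sup>2) / real T
      else
        (\<Sum>t=1..T. K_scaled K h (X i t - x) * (Y_star n T Y i t - m_hat K n T X Y i h (X i t))\<^sup>2)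
        / (\<Sum>t=1..T. K_scaled K h (X i t - x)))"

definition nu_hat ::
  "bool \<Rightarrow> (real \<Rightarrow> real) \<Rightarrow> nat \<Rightarrow> nat \<Rightarrow> panel \<Rightarrow> panel \<Rightarrow> nat \<Rightarrow> nat \<Rightarrow> real \<Rightarrow> real \<Rightarrow> real" where
  "nu_hat pooled K n T X Y i j x h =
     (sigma2_hat pooled K n T X Y i h x / f_hat K T X i h x
      + sigma2_hat pooled K n T X Y j h x / f_hat K T X j h x) * s_const K x h"

definition psi_hat ::
  "bool \<Rightarrow> (real \<Rightarrow> real) \<Rightarrow> nat \<Rightarrow> nat \<Rightarrow> panel \<Rightarrow> panel \<Rightarrow> nat \<Rightarrow> nat \<Rightarrow> real \<Rightarrow> real \<Rightarrow> real" where
  "psi_hat pooled K n T X Y i j x h =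
     sqrt (real T * h) * (m_hat K n T X Y i h x - m_hat K n T X Y j h x)
     / sqrt (nu_hat pooled K n T X Y i j x h)"


section \<open>The multiscale statistic\<close>

definition lambda :: "real \<Rightarrow> real" where
  "lambda r = sqrt (2 * ln (1 / r))"

definition d_hat ::
  "bool \<Rightarrow> (real \<Rightarrow> real) \<Rightarrow> nat \<Rightarrow> nat \<Rightarrow> (real \<times> real) set \<Rightarrow> panel \<Rightarrow> panel \<Rightarrow> nat \<Rightarrow> nat \<Rightarrow> real" where
  "d_hat pooled K n T grid X Y i j =
     (MAX (x, h)\<in>grid. \<bar>psi_hat pooled K n T X Y i j x h\<bar> - lambda (2 * h))"

text \<open>Since the full region \<open>{0..1} \<times> {h_min T..h_max T}\<close> itself varies with \<open>T\<close>, the grid becoming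
  dense in it means that the largest distance from a point of the region to the grid vanishes.\<close>

definition location_scale_grid ::
  "(nat \<Rightarrow> (real \<times> real) set) \<Rightarrow> (nat \<Rightarrow> real) \<Rightarrow> (nat \<Rightarrow> real) \<Rightarrow> bool" where
  "location_scale_grid grid h_min h_max \<longleftrightarrow>
     (\<forall>T\<ge>1. h_min T \<le> h_max T \<and> grid T \<subseteq> {0..1} \<times> {h_min T..h_max T}) \<and>
     (\<forall>e>0. \<forall>\<^sub>F T in sequentially.
        \<forall>p\<in>{0..1} \<times> {h_min T..h_max T}. \<exists>q\<in>grid T. dist p q < e) \<and>
     (\<exists>C \<beta>. C > 0 \<and> \<beta> > 0 \<and>
        (\<forall>T\<ge>1. finite (grid T) \<and> real (card (grid T)) \<le> C * real T powr \<beta>)) \<and>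
     (\<exists>\<delta> c C. \<delta> > 0 \<and> c > 0 \<and> C > 0 \<and>
        (\<forall>T\<ge>1. h_min T \<ge> c * real T powr (- (1 - \<delta>)) \<and> h_max T \<le> C * real T powr (- \<delta>)))"


section \<open>Hierarchical agglomerative clustering\<close>

definition Delta :: "(nat \<Rightarrow> nat \<Rightarrow> real) \<Rightarrow> nat set \<Rightarrow> nat set \<Rightarrow> real" where
  "Delta d S S' = (MAX (i, j)\<in>S \<times> S'. d i j)"

text \<open>The clusters of a step are kept as an unordered partition. Merging is a relation: ties
  between several closest pairs may be resolved in any way.\<close>

definition hac_step :: "(nat \<Rightarrow> nat \<Rightarrow> real) \<Rightarrow> nat set set \<Rightarrow> nat set set \<Rightarrow> bool" where
  "hac_step d P P' \<longleftrightarrow>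
     (\<exists>A\<in>P. \<exists>B\<in>P. A \<noteq> B \<and>
        (\<forall>A'\<in>P. \<forall>B'\<in>P. A' \<noteq> B' \<longrightarrow> Delta d A B \<le> Delta d A' B') \<and>
        P' = insert (A \<union> B) (P - {A, B}))"

definition hac_run :: "(nat \<Rightarrow> nat \<Rightarrow> real) \<Rightarrow> nat \<Rightarrow> (nat \<Rightarrow> nat set set) \<Rightarrow> bool" where
  "hac_run d n P \<longleftrightarrow>
     P 0 = (\<lambda>i. {i}) ` {1..n} \<and> (\<forall>r\<in>{1..n - 1}. hac_step d (P (r - 1)) (P r))"

definition K0_hat :: "(nat \<Rightarrow> nat \<Rightarrow> real) \<Rightarrow> nat \<Rightarrow> (nat \<Rightarrow> nat set set) \<Rightarrow> real \<Rightarrow> nat" where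
  "K0_hat d n P thr = (LEAST K. K \<in> {1..n} \<and> (MAX S\<in>P (n - K). Delta d S S) \<le> thr)"

end

theory Submission
  imports Defs
begin

text \<open>The merge rule depends on \<open>d\<close> only through complete linkage. If all within-group values of
  \<open>d\<close> are at most \<open>c\<close> and all between-group values exceed \<open>c\<close>, then as long as there are more clusters
  than groups, some two clusters lie in the same group by pigeonhole, so the closest pair has
  dissimilarity at most \<open>c\<close> and merging it stays inside a group. Hence the partition into as many
  clusters as groups has diameter at most \<open>c\<close>, whereas a coarser one has a cluster meeting two groups.
  The assumed rates make this separation hold for \<open>c = thr T\<close> with probability tending to 1.\<close>

section \<open>Diameters and refinements of finite partitions\<close>

lemma Delta_le_iff:
  assumes "finite S" "finite S'" "S \<noteq> {}" "S' \<noteq> {}"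
  shows "Delta d S S' \<le> c \<longleftrightarrow> (\<forall>i\<in>S. \<forall>j\<in>S'. d i j \<le> c)"
  using assms by (auto simp: Delta_def)

text \<open>\<open>MAX\<close> over an empty set is unspecified, so the equivalence rests on the
  partition and all its blocks being non-empty; the former needs
  \<open>A \<noteq> {}\<close>.\<close>

lemma diameter_le_iff:
  assumes "finite A" "partition_on A P" "A \<noteq> {}"
  shows "(MAX S\<in>P. Delta d S S) \<le> c \<longleftrightarrow> (\<forall>S\<in>P. \<forall>i\<in>S. \<forall>j\<in>S. d i j \<le> c)"
proof -
  have "finite P" "P \<noteq> {}"
    using assms finite_elements partition_onD1 by auto
  moreover have "finite S" "S \<noteq> {}" if "S \<in> P" for S
    using that assms partition_onD1[OF assms(2)] partition_onD3[OF assms(2)]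
    by (auto intro: finite_subset)
  ultimately show ?thesis
    by (auto simp: Delta_le_iff)
qed

text \<open>Sending each block of the finer partition to a block of \<open>Q\<close> containing it
  is a surjection: a block of \<open>Q\<close> has a point, and the \<open>P\<close>-block of that
  point can only be sent there, by disjointness.\<close>

lemma card_le_of_refines:
  assumes "finite A" "refines A P Q"
  shows "card Q \<le> card P"
proof -
  have P: "partition_on A P" and Q: "partition_on A Q"
    and sub: "\<And>X. X \<in> P \<Longrightarrow> \<exists>Y\<in>Q. X \<subseteq> Y"
    using assms by (auto simp: refines_def)
  obtain f where f: "\<And>X. X \<in> P \<Longrightarrow> f X \<in> Q \<and> X \<subseteq> f X"
    using sub by metis
  have "Y \<in> f ` P" if Y: "Y \<in> Q" for Y
  proof -
    obtain x where x: "x \<in> Y"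
      using Y partition_onD3[OF Q] by (metis equals0I)
    with Y have "x \<in> A"
      using partition_onD1[OF Q] by blast
    then obtain X where X: "X \<in> P" "x \<in> X"
      using partition_onD1[OF P] by blast
    with x f[OF X(1)] have "f X = Y"
      using partition_onD2[OF Q] Y by (auto simp: disjoint_def)
    with X show ?thesis by blast
  qed
  then have "Q \<subseteq> f ` P" by blast
  then show ?thesis
    using finite_elements[OF assms(1) P] by (meson surj_card_le)
qed

text \<open>With fewer blocks in \<open>Q\<close>, the map from blocks of \<open>P\<close> to
  enclosing blocks of \<open>Q\<close> cannot be injective. The two blocks with a common image
  provide a cheap merge in the clustering argument.\<close>

lemma refines_coarse_pair:
  assumes "finite A" "refines A P Q" "card Q < card P"
  obtains S S' C where "S \<in> P" "S' \<in> P" "S \<noteq> S'" "C \<in> Q" "S \<subseteq> C" "S' \<subseteq> C"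
proof -
  obtain f where f: "\<And>X. X \<in> P \<Longrightarrow> f X \<in> Q \<and> X \<subseteq> f X"
    using assms(2) unfolding refines_def by metis
  have "finite Q"
    using assms finite_elements by (auto simp: refines_def)
  then have "card (f ` P) \<le> card Q"
    using f by (auto intro: card_mono)
  then have "\<not> inj_on f P"
    using assms(3) by (intro pigeonhole) simp
  then show ?thesis
    using f that by (metis inj_onI)
qed

section \<open>Agglomerative clustering under separation\<close>

lemma hac_step_partition_on:
  assumes "hac_step d P P'" "partition_on U P" "finite U"
  shows "partition_on U P'" "card P' = card P - 1"
proof -
  obtain A B where AB: "A \<in> P" "B \<in> P" "A \<noteq> B" "P' = insert (A \<union> B) (P - {A, B})"
    using assms(1) unfolding hac_step_def by blast
  have disj: "X \<inter> Y = {}" if "X \<in> P" "Y \<in> P" "X \<noteq> Y" for X Y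
    using partition_onD2[OF assms(2)] that by (auto simp: disjoint_def)
  have ne: "X \<noteq> {}" if "X \<in> P" for X
    using partition_onD3[OF assms(2)] that by blast
  \<comment> \<open>The merged cluster must be new for the count to drop by exactly one. Were it
    already a block, disjointness would make it equal to both \<open>A\<close> and
    \<open>B\<close>.\<close>
  have fresh: "A \<union> B \<notin> P"
  proof
    assume "A \<union> B \<in> P"
    then have "A \<union> B = A" "A \<union> B = B"
      using disj[of "A \<union> B" A] disj[of "A \<union> B" B] ne[OF AB(1)] ne[OF AB(2)] AB(1,2)
      by blast+
    with AB(3) show False by simp
  qed
  show "partition_on U P'"
  proof (rule partition_onI)
    show "\<Union> P' = U"
      using partition_onD1[OF assms(2)] AB by auto
    show "{} \<notin> P'"
      using ne AB(1) ne[OF AB(1)] unfolding AB(4) by blast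
    fix p q assume "p \<in> P'" "q \<in> P'" "p \<noteq> q"
    moreover have "disjnt (A \<union> B) S" if "S \<in> P - {A, B}" for S
      using that disj[of A S] disj[of B S] AB(1,2) unfolding disjnt_def by blast
    moreover have "disjnt S S'" if "S \<in> P - {A, B}" "S' \<in> P - {A, B}" "S \<noteq> S'" for S S'
      using that disj[of S S'] unfolding disjnt_def by blast
    ultimately show "disjnt p q"
      unfolding AB(4) by (metis disjnt_sym insert_iff)
  qed
  have "finite P"
    using assms finite_elements by blast
  then have "card P' = Suc (card (P - {A, B}))"
    using fresh AB by simp
  also have "card (P - {A, B}) = card P - 2"
    using AB by (subst card_Diff_subset) auto
  also have "Suc (card P - 2) = card P - 1"
    using AB card_mono[OF \<open>finite P\<close>, of "{A, B}"] by simp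
  finally show "card P' = card P - 1" .
qed

lemma hac_run_partition_on:
  assumes "hac_run d n P" "r \<le> n - 1"
  shows "partition_on {1..n} (P r) \<and> card (P r) = n - r"
  using assms(2)
proof (induction r)
  case 0
  have "card ((\<lambda>i. {i}) ` {1..n}) = n"
    by (subst card_image) auto
  then show ?case
    using assms(1) partition_on_singletons by (auto simp: hac_run_def)
next
  case (Suc r)
  then have "hac_step d (P r) (P (Suc r))"
    using assms(1) unfolding hac_run_def by force
  then show ?case
    using hac_step_partition_on[of d "P r" "P (Suc r)" "{1..n}"] Suc by auto
qed

text \<open>A single equivalence encodes both bounds: at most \<open>c\<close> inside a block, above
  \<open>c\<close> across blocks. Diagonal pairs are included because the diameter
  \<open>Delta d S S\<close> contains them.\<close>

definition separates :: "('i \<Rightarrow> 'i \<Rightarrow> real) \<Rightarrow> 'i set set \<Rightarrow> real \<Rightarrow> bool" where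
  "separates d \<C> c \<longleftrightarrow>
     (\<forall>A\<in>\<C>. \<forall>B\<in>\<C>. \<forall>i\<in>A. \<forall>j\<in>B. d i j \<le> c \<longleftrightarrow> A = B)"

text \<open>Only minimality of the merged pair is used, so any resolution of ties is
  covered.\<close>

lemma hac_step_refines:
  assumes "finite U" "refines U P \<C>" "card \<C> < card P" "separates d \<C> c" "hac_step d P P'"
  shows "refines U P' \<C>"
proof -
  have P: "partition_on U P"
    using assms(2) by (simp add: refines_def)
  have fin: "finite S" "S \<noteq> {}" if "S \<in> P" for S
    using that assms(1) partition_onD1[OF P] partition_onD3[OF P] by (auto intro: finite_subset)
  have sub: "\<exists>C\<in>\<C>. S \<subseteq> C" if "S \<in> P" for S
    using that assms(2) by (simp add: refines_def)
  obtain A B where AB: "A \<in> P" "B \<in> P" "P' = insert (A \<union> B) (P - {A, B})"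
    and least: "\<And>A' B'. A' \<in> P \<Longrightarrow> B' \<in> P \<Longrightarrow> A' \<noteq> B' \<Longrightarrow> Delta d A B \<le> Delta d A' B'"
    using assms(5) unfolding hac_step_def by blast
  obtain S S' C where S: "S \<in> P" "S' \<in> P" "S \<noteq> S'" "C \<in> \<C>" "S \<subseteq> C" "S' \<subseteq> C"
    using refines_coarse_pair[OF assms(1-3)] .
  have "Delta d S S' \<le> c"
    using S(4-6) assms(4) unfolding separates_def Delta_le_iff[OF fin(1)[OF S(1)] fin(1)[OF S(2)]
      fin(2)[OF S(1)] fin(2)[OF S(2)]] by blast
  then have "Delta d A B \<le> c"
    using least S order_trans by blast
  then have small: "d i j \<le> c" if "i \<in> A" "j \<in> B" for i j
    using that AB fin by (simp add: Delta_le_iff)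
  obtain CA CB where C: "CA \<in> \<C>" "A \<subseteq> CA" "CB \<in> \<C>" "B \<subseteq> CB"
    using sub AB by metis
  \<comment> \<open>One cross pair with value at most \<open>c\<close> already identifies the two
    enclosing blocks, since values across different blocks exceed \<open>c\<close>.\<close>
  obtain i j where "i \<in> A" "j \<in> B"
    using fin AB by blast
  then have "CA = CB"
    using small C assms(4) unfolding separates_def by blast
  then have "\<exists>C\<in>\<C>. S \<subseteq> C" if "S \<in> P'" for S
    using that AB C sub by blast
  then show ?thesis
    using hac_step_partition_on(1)[OF assms(5) P assms(1)] assms(2) by (simp add: refines_def)
qed

lemma hac_run_refines:
  assumes "hac_run d n P" "partition_on {1..n} \<C>" "separates d \<C> c" "r \<le> n - card \<C>" "\<C> \<noteq> {}"
  shows "refines {1..n} (P r) \<C>"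
  using assms(4)
proof (induction r)
  case 0
  have "P 0 = (\<lambda>i. {i}) ` {1..n}"
    using assms(1) by (simp add: hac_run_def)
  then show ?case
    using assms(2) partition_on_singletons partition_onD1[OF assms(2)] by (auto simp: refines_def)
next
  case (Suc r)
  \<comment> \<open>This keeps \<open>Suc r\<close> within the \<open>n - 1\<close> merges of a run,
    while \<open>Suc r \<le> n - card \<C>\<close> leaves more clusters than blocks before the
    merge.\<close>
  have "card \<C> \<ge> 1"
    using assms(2,5) finite_elements by (auto simp: card_gt_0_iff Suc_le_eq)
  with Suc.prems have r: "Suc r \<le> n - 1" "card \<C> < n - r"
    by auto
  then have "hac_step d (P r) (P (Suc r))"
    using assms(1) unfolding hac_run_def by force
  moreover have "card (P r) = n - r"
    using hac_run_partition_on[OF assms(1), of r] r by simp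
  ultimately show ?case
    using hac_step_refines[of "{1..n}" "P r" \<C> d c "P (Suc r)"] Suc assms(3) r by auto
qed

lemma K0_hat_eq_card:
  assumes run: "hac_run d n P" and \<C>: "partition_on {1..n} \<C>" and sep: "separates d \<C> c"
    and "n \<ge> 1"
  shows "K0_hat d n P c = card \<C>"
  unfolding K0_hat_def
proof (rule Least_equality)
  have "\<C> \<noteq> {}"
    using partition_onD1[OF \<C>] \<open>n \<ge> 1\<close> by auto
  then have "card \<C> \<ge> 1"
    using finite_elements[OF _ \<C>] by (auto simp: card_gt_0_iff Suc_le_eq)
  have ref: "refines {1..n} (P (n - card \<C>)) \<C>"
    using hac_run_refines[OF run \<C> sep _ \<open>\<C> \<noteq> {}\<close>] by simp
  \<comment> \<open>The initial partition has \<open>n\<close> singletons, so comparing it with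
    \<open>\<C>\<close> shows that \<open>card \<C>\<close> is an admissible index.\<close>
  have "refines {1..n} (P 0) \<C>"
    using hac_run_refines[OF run \<C> sep _ \<open>\<C> \<noteq> {}\<close>] by simp
  then have "card \<C> \<le> n"
    using card_le_of_refines[of "{1..n}" "P 0" \<C>] hac_run_partition_on[OF run, of 0] by simp
  moreover have "d i j \<le> c" if S: "S \<in> P (n - card \<C>)" "i \<in> S" "j \<in> S" for S i j
  proof -
    obtain C where C: "C \<in> \<C>" "S \<subseteq> C"
      using S(1) ref by (auto simp: refines_def)
    then have "i \<in> C" "j \<in> C"
      using S(2,3) by auto
    with C(1) sep show ?thesis
      by (auto simp: separates_def)
  qed
  moreover have "partition_on {1..n} (P (n - card \<C>))"
    using ref by (simp add: refines_def)
  ultimately show "card \<C> \<in> {1..n} \<and> (MAX S\<in>P (n - card \<C>). Delta d S S) \<le> c"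
    using \<open>card \<C> \<ge> 1\<close> \<open>n \<ge> 1\<close> diameter_le_iff[of "{1..n}" "P (n - card \<C>)" d c]
    by simp
next
  \<comment> \<open>Minimality needs from the run only that \<open>P (n - K)\<close> is a partition
    into \<open>K\<close> clusters: a cluster of diameter at most \<open>c\<close> fits inside one
    block, so this partition refines \<open>\<C>\<close>.\<close>
  fix K assume K: "K \<in> {1..n} \<and> (MAX S\<in>P (n - K). Delta d S S) \<le> c"
  then have P: "partition_on {1..n} (P (n - K))" "card (P (n - K)) = K"
    using hac_run_partition_on[OF run, of "n - K"] by auto
  with K have small: "\<And>S i j. S \<in> P (n - K) \<Longrightarrow> i \<in> S \<Longrightarrow> j \<in> S \<Longrightarrow> d i j \<le> c"
    using diameter_le_iff[of "{1..n}" "P (n - K)"] by auto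
  have "\<exists>C\<in>\<C>. S \<subseteq> C" if S: "S \<in> P (n - K)" for S
  proof -
    have cover: "\<exists>C\<in>\<C>. j \<in> C" if "j \<in> S" for j
      using that S partition_onD1[OF P(1)] partition_onD1[OF \<C>] by blast
    obtain i where "i \<in> S"
      using S partition_onD3[OF P(1)] by (metis equals0I)
    moreover then obtain C where "C \<in> \<C>" "i \<in> C"
      using cover by blast
    ultimately have "j \<in> C" if "j \<in> S" for j
      using cover[OF that] small[OF S \<open>i \<in> S\<close> that] sep \<open>C \<in> \<C>\<close> \<open>i \<in> C\<close>
      unfolding separates_def by metis
    with \<open>C \<in> \<C>\<close> show ?thesis by blast
  qed
  then have "refines {1..n} (P (n - K)) \<C>"
    using P \<C> by (simp add: refines_def)
  then show "card \<C> \<le> K"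
    using card_le_of_refines[of "{1..n}" "P (n - K)" \<C>] P by simp
qed

section \<open>Symmetry and measurability of the statistics\<close>

lemma d_hat_commute: "d_hat pooled K n T grid X Y i j = d_hat pooled K n T grid X Y j i"
proof -
  \<comment> \<open>Swapping the indices flips the sign of the numerator and leaves the variance
    term unchanged.\<close>
  have "\<bar>psi_hat pooled K n T X Y i j x h\<bar> = \<bar>psi_hat pooled K n T X Y j i x h\<bar>" for x h
    by (simp add: psi_hat_def nu_hat_def abs_mult abs_minus_commute add.commute)
  then show ?thesis
    by (simp add: d_hat_def)
qed

lemma Y_star_measurable:
  assumes "\<And>i t. i \<in> {1..n} \<Longrightarrow> t \<in> {1..T} \<Longrightarrow> Y i t \<in> borel_measurable M"
    and "i \<in> {1..n}" "t \<in> {1..T}"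
  shows "(\<lambda>\<omega>. Y_star n T (\<lambda>i t. Y i t \<omega>) i t) \<in> borel_measurable M"
  unfolding Y_star_def using assms
  by (intro borel_measurable_add borel_measurable_diff borel_measurable_divide borel_measurable_sum
      borel_measurable_const) auto

lemma K_scaled_measurable:
  assumes "K \<in> borel_measurable borel" "f \<in> borel_measurable M"
  shows "(\<lambda>\<omega>. K_scaled K h (f \<omega>)) \<in> borel_measurable M"
  unfolding K_scaled_def using assms by measurable

text \<open>The evaluation point \<open>x\<close> is allowed to be random because the residuals in
  \<open>sigma2_hat\<close> evaluate the fit at the observed regressors.\<close>

lemma W_loc_measurable:
  assumes K: "K \<in> borel_measurable borel"
    and X: "\<And>t. t \<in> {1..T} \<Longrightarrow> X i t \<in> borel_measurable M"
    and x [measurable]: "x \<in> borel_measurable M"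
    and t: "t \<in> {1..T}"
  shows "(\<lambda>\<omega>. W_loc K T (\<lambda>i t. X i t \<omega>) i t (x \<omega>) h) \<in> borel_measurable M"
proof -
  have dev: "(\<lambda>\<omega>. X i t \<omega> - x \<omega>) \<in> borel_measurable M" if "t \<in> {1..T}" for t
    using X[OF that] by measurable
  have S: "(\<lambda>\<omega>. S_loc K T (\<lambda>i t. X i t \<omega>) i l (x \<omega>) h) \<in> borel_measurable M" for l
    unfolding S_loc_def
    by (intro borel_measurable_divide borel_measurable_sum borel_measurable_times
        borel_measurable_power K_scaled_measurable[OF K] dev borel_measurable_const)
  show ?thesis
    unfolding W_loc_def
    by (intro borel_measurable_divide borel_measurable_times borel_measurable_diff
        K_scaled_measurable[OF K] dev S t borel_measurable_const)
qed

lemma m_hat_measurable: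
  assumes "K \<in> borel_measurable borel"
    and "\<And>i t. i \<in> {1..n} \<Longrightarrow> t \<in> {1..T} \<Longrightarrow> X i t \<in> borel_measurable M"
    and "\<And>i t. i \<in> {1..n} \<Longrightarrow> t \<in> {1..T} \<Longrightarrow> Y i t \<in> borel_measurable M"
    and "i \<in> {1..n}" "x \<in> borel_measurable M"
  shows "(\<lambda>\<omega>. m_hat K n T (\<lambda>i t. X i t \<omega>) (\<lambda>i t. Y i t \<omega>) i h (x \<omega>)) \<in> borel_measurable M"
  unfolding m_hat_def
  by (intro borel_measurable_divide borel_measurable_times borel_measurable_sum
      W_loc_measurable Y_star_measurable assms)

lemma sigma2_hat_measurable:
  assumes K: "K \<in> borel_measurable borel"
    and X: "\<And>i t. i \<in> {1..n} \<Longrightarrow> t \<in> {1..T} \<Longrightarrow> X i t \<in> borel_measurable M"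
    and Y: "\<And>i t. i \<in> {1..n} \<Longrightarrow> t \<in> {1..T} \<Longrightarrow> Y i t \<in> borel_measurable M"
    and i: "i \<in> {1..n}"
  shows "(\<lambda>\<omega>. sigma2_hat pooled K n T (\<lambda>i t. X i t \<omega>) (\<lambda>i t. Y i t \<omega>) i h x) \<in> borel_measurable M"
  unfolding sigma2_hat_def
  by (cases pooled; simp only: if_True if_False;
      intro borel_measurable_divide borel_measurable_times borel_measurable_sum borel_measurable_diff
      borel_measurable_power K_scaled_measurable m_hat_measurable Y_star_measurable
      borel_measurable_const K X Y i)

lemma psi_hat_measurable:
  assumes K: "K \<in> borel_measurable borel"
    and X: "\<And>i t. i \<in> {1..n} \<Longrightarrow> t \<in> {1..T} \<Longrightarrow> X i t \<in> borel_measurable M"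
    and Y: "\<And>i t. i \<in> {1..n} \<Longrightarrow> t \<in> {1..T} \<Longrightarrow> Y i t \<in> borel_measurable M"
    and ij: "i \<in> {1..n}" "j \<in> {1..n}"
  shows "(\<lambda>\<omega>. psi_hat pooled K n T (\<lambda>i t. X i t \<omega>) (\<lambda>i t. Y i t \<omega>) i j x h) \<in> borel_measurable M"
proof -
  have f: "(\<lambda>\<omega>. f_hat K T (\<lambda>i t. X i t \<omega>) i h x) \<in> borel_measurable M" if "i \<in> {1..n}" for i
    unfolding f_hat_def
    by (intro borel_measurable_divide borel_measurable_sum borel_measurable_diff
        K_scaled_measurable borel_measurable_const K X that)
  show ?thesis
    unfolding psi_hat_def nu_hat_def
    by (intro borel_measurable_divide borel_measurable_times borel_measurable_add
        borel_measurable_diff measurable_compose[OF _ borel_measurable_sqrt] m_hat_measurable sigma2_hat_measurable f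
        borel_measurable_const K X Y ij)
qed

lemma d_hat_measurable:
  assumes "K \<in> borel_measurable borel" "finite grid"
    and "\<And>i t. i \<in> {1..n} \<Longrightarrow> t \<in> {1..T} \<Longrightarrow> X i t \<in> borel_measurable M"
    and "\<And>i t. i \<in> {1..n} \<Longrightarrow> t \<in> {1..T} \<Longrightarrow> Y i t \<in> borel_measurable M"
    and "i \<in> {1..n}" "j \<in> {1..n}"
  shows "(\<lambda>\<omega>. d_hat pooled K n T grid (\<lambda>i t. X i t \<omega>) (\<lambda>i t. Y i t \<omega>) i j) \<in> borel_measurable M"
  unfolding d_hat_def case_prod_beta
  by (intro borel_measurable_Max borel_measurable_diff borel_measurable_abs psi_hat_measurable
      borel_measurable_const assms)

text \<open>Every partition of the run lies in the finite set \<open>Pow (Pow {1..n})\<close>. It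
  therefore suffices to treat one fixed partition at a time, where the diameter is a maximum of
  finitely many measurable functions.\<close>

lemma K0_hat_measurable:
  assumes d: "\<And>i j. i \<in> {1..n} \<Longrightarrow> j \<in> {1..n} \<Longrightarrow> (\<lambda>\<omega>. d \<omega> i j) \<in> borel_measurable M"
    and run: "\<And>\<omega>. \<omega> \<in> space M \<Longrightarrow> hac_run (d \<omega>) n (P \<omega>)"
    and P: "\<And>r. r \<le> n - 1 \<Longrightarrow> (\<lambda>\<omega>. P \<omega> r) \<in> measurable M (count_space UNIV)"
  shows "(\<lambda>\<omega>. K0_hat (d \<omega>) n (P \<omega>) c) \<in> measurable M (count_space UNIV)"
proof -
  have diam: "(\<lambda>\<omega>. MAX S\<in>P \<omega> r. Delta (d \<omega>) S S) \<in> borel_measurable M" if r: "r \<le> n - 1" for r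
  proof (rule measurable_compose_countable'[where g = "\<lambda>\<omega>. P \<omega> r" and I = "Pow (Pow {1..n})"])
    fix Q assume Q: "Q \<in> Pow (Pow {1..n})"
    then have "finite S" if "S \<in> Q" for S
      using that finite_subset by blast
    moreover have "finite Q"
      using Q by (meson Pow_iff finite_Pow_iff finite_atLeastAtMost finite_subset)
    moreover have "i \<in> {1..n}" if "S \<in> Q" "i \<in> S" for S i
      using that Q by blast
    ultimately show "(\<lambda>\<omega>. MAX S\<in>Q. Delta (d \<omega>) S S) \<in> borel_measurable M"
      unfolding Delta_def case_prod_beta
      by (intro borel_measurable_Max d finite_cartesian_product) (auto simp del: atLeastAtMost_iff)
  next
    have "P \<omega> r \<in> Pow (Pow {1..n})" if "\<omega> \<in> space M" for \<omega>
      using hac_run_partition_on[OF run[OF that] r] by (auto simp: partition_on_def)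
    then show "(\<lambda>\<omega>. P \<omega> r) \<in> measurable M (count_space (Pow (Pow {1..n})))"
      using P[OF r] by (auto simp: measurable_def)
  qed (simp add: countable_finite)
  have "Measurable.pred M (\<lambda>\<omega>. K \<in> {1..n} \<and> (MAX S\<in>P \<omega> (n - K). Delta (d \<omega>) S S) \<le> c)" for K
  proof (cases "K \<in> {1..n}")
    case True
    then have [measurable]: "(\<lambda>\<omega>. MAX S\<in>P \<omega> (n - K). Delta (d \<omega>) S S) \<in> borel_measurable M"
      by (intro diam) auto
    show ?thesis by measurable
  next
    \<comment> \<open>The predicate is constantly false here. For \<open>K = 0\<close> and
      \<open>n \<ge> 1\<close> the index \<open>n - K\<close> lies past the last merge, where
      nothing is assumed about \<open>P\<close>.\<close>
    case False
    then show ?thesis by (simp del: atLeastAtMost_iff)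
  qed
  then show ?thesis
    unfolding K0_hat_def by (rule measurable_Least)
qed

section \<open>From stochastic rates to convergence in probability\<close>

text \<open>For each \<open>e\<close>, stochastic boundedness provides a \<open>B\<close> with tail
  probability below \<open>e\<close> at level \<open>B * \<bar>b T\<bar>\<close>. As
  \<open>b\<close> is of smaller order, \<open>c T\<close> eventually exceeds that level, so its
  tail event is contained in the former one.\<close>

lemma bigO_p_tendsto_0:
  assumes "bigO_p M Z b" "b \<in> o(c)" "\<forall>\<^sub>F T in sequentially. c T > 0"
    and "\<forall>\<^sub>F T in sequentially. prob_space (M T)"
  shows "(\<lambda>T. measure (M T) {\<omega> \<in> space (M T). \<bar>Z T \<omega>\<bar> > c T}) \<longlonglongrightarrow> 0"
proof (rule order_tendstoI)
  fix e :: real assume "e > 0"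
  then obtain B where "B > 0" and
    B: "\<forall>\<^sub>F T in sequentially. measure (M T) {\<omega> \<in> space (M T). \<bar>Z T \<omega>\<bar> > B * \<bar>b T\<bar>} < e"
    using assms(1) unfolding bigO_p_def by blast
  have "\<forall>\<^sub>F T in sequentially. norm (b T) \<le> (1 / B) * norm (c T)"
    using \<open>B > 0\<close> by (intro landau_o.smallD[OF assms(2)]) simp
  moreover have "\<forall>\<^sub>F T in sequentially. Z T \<in> borel_measurable (M T)"
    using assms(1) by (simp add: bigO_p_def)
  ultimately show "\<forall>\<^sub>F T in sequentially. measure (M T) {\<omega> \<in> space (M T). \<bar>Z T \<omega>\<bar> > c T} < e"
    using B assms(3,4)
  proof eventually_elim
    case (elim T)
    interpret prob_space "M T" by fact
    note [measurable] = elim(2)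
    have "B * \<bar>b T\<bar> \<le> c T"
      using elim(1,4) \<open>B > 0\<close> by (simp add: field_simps)
    then have "measure (M T) {\<omega> \<in> space (M T). \<bar>Z T \<omega>\<bar> > c T}
        \<le> measure (M T) {\<omega> \<in> space (M T). \<bar>Z T \<omega>\<bar> > B * \<bar>b T\<bar>}"
      by (intro finite_measure_mono) auto
    with elim(3) show ?case by simp
  qed
qed (auto intro!: always_eventually less_le_trans[OF _ measure_nonneg])

theorem theorem5p1:
  fixes M :: "nat \<Rightarrow> 'a measure"
    and n :: "nat \<Rightarrow> nat"
    and K0 :: nat
    and G :: "nat \<Rightarrow> nat \<Rightarrow> nat set"
    and g :: "nat \<Rightarrow> real \<Rightarrow> real"
    and m :: "nat \<Rightarrow> nat \<Rightarrow> real \<Rightarrow> real"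
    and X Y \<epsilon> :: "nat \<Rightarrow> nat \<Rightarrow> nat \<Rightarrow> 'a \<Rightarrow> real"
    and \<alpha> \<gamma> :: "nat \<Rightarrow> nat \<Rightarrow> 'a \<Rightarrow> real"
    and K :: "real \<Rightarrow> real"
    and grid :: "nat \<Rightarrow> (real \<times> real) set"
    and h_min h_max :: "nat \<Rightarrow> real"
    and pooled :: bool
    and d :: "nat \<Rightarrow> 'a \<Rightarrow> nat \<Rightarrow> nat \<Rightarrow> real"
    and c0 :: real
    and thr :: "nat \<Rightarrow> real"
    and G_hat :: "nat \<Rightarrow> 'a \<Rightarrow> nat \<Rightarrow> nat set set"
  assumes model: "grouped_panel_model M n K0 G g m X Y \<epsilon> \<alpha> \<gamma>"
    and kernel: "smoothing_kernel K"
    and grid: "location_scale_grid grid h_min h_max"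
    and pooled: "pooled \<Longrightarrow> homoskedastic M n X \<epsilon>"
    and d_eq: "\<And>T \<omega> i j. d T \<omega> i j =
          d_hat pooled K (n T) T (grid T) (\<lambda>i t. X T i t \<omega>) (\<lambda>i t. Y T i t \<omega>) i j"
    and within: "bigO_p M
          (\<lambda>T \<omega>. MAX k\<in>{1..K0}. MAX (i, j)\<in>G T k \<times> G T k. d T \<omega> i j)
          (\<lambda>T. sqrt (ln (real (n T)) + ln (real T)))"
    and c0: "c0 > 0"
    and between: "K0 \<ge> 2 \<Longrightarrow>
          \<exists>R. smallo_p M R (\<lambda>T. sqrt (real T * h_max T)) \<and>
            (\<forall>\<^sub>F T in sequentially. \<forall>\<omega>\<in>space (M T).
               (MIN (k, k')\<in>{(k, k'). 1 \<le> k \<and> k < k' \<and> k' \<le> K0}.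
                  MIN (i, j)\<in>G T k \<times> G T k'. d T \<omega> i j)
               \<ge> c0 * sqrt (real T * h_max T) + R T \<omega>)"
    and thr_pos: "\<forall>\<^sub>F T in sequentially. thr T > 0"
    and thr_lower: "(\<lambda>T. sqrt (ln (real (n T)) + ln (real T))) \<in> o(thr)"
    and thr_upper: "thr \<in> o(\<lambda>T. sqrt (real T * h_max T))"
    and hac: "\<And>T \<omega>. T \<ge> 1 \<Longrightarrow> \<omega> \<in> space (M T) \<Longrightarrow> hac_run (d T \<omega>) (n T) (G_hat T \<omega>)"
    and hac_measurable: "\<And>T r. T \<ge> 1 \<Longrightarrow> r \<le> n T - 1 \<Longrightarrow>
          (\<lambda>\<omega>. G_hat T \<omega> r) \<in> measurable (M T) (count_space UNIV)"
  shows "(\<lambda>T. measure (M T) {\<omega> \<in> space (M T). K0_hat (d T \<omega>) (n T) (G_hat T \<omega>) (thr T) = K0})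
           \<longlonglongrightarrow> 1"
proof -
  interpret grouped_panel_model M n K0 G g m X Y \<epsilon> \<alpha> \<gamma>
    by (fact model)
  let ?s = "\<lambda>T. sqrt (real T * h_max T)"
  let ?W = "\<lambda>T \<omega>. MAX k\<in>{1..K0}. MAX (i, j)\<in>G T k \<times> G T k. d T \<omega> i j"
  let ?I = "{(k, k'). 1 \<le> k \<and> k < k' \<and> k' \<le> K0}"
  let ?E = "\<lambda>T. {\<omega> \<in> space (M T). K0_hat (d T \<omega>) (n T) (G_hat T \<omega>) (thr T) = K0}"
  have prob: "\<forall>\<^sub>F T in sequentially. prob_space (M T)"
    using eventually_ge_at_top[of 1] by eventually_elim (rule prob_space_M)
  have K: "K \<in> borel_measurable borel"
    using kernel by (simp add: smoothing_kernel_def)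
  have fin_grid: "finite (grid T)" if "T \<ge> 1" for T
    using grid that unfolding location_scale_grid_def by blast
  have d_commute: "d T \<omega> i j = d T \<omega> j i" for T \<omega> i j
    unfolding d_eq by (rule d_hat_commute)
  have d_meas: "(\<lambda>\<omega>. d T \<omega> i j) \<in> borel_measurable (M T)"
    if "T \<ge> 1" "i \<in> {1..n T}" "j \<in> {1..n T}" for T i j
    unfolding d_eq
    by (intro d_hat_measurable K fin_grid X_measurable Y_measurable that)
  \<comment> \<open>Since \<open>measure\<close> is 0 outside the sigma-algebra, a lower bound on
    the probability of this event requires its measurability.\<close>
  have E_sets: "?E T \<in> sets (M T)" if "T \<ge> 1" for T
  proof -
    have [measurable]:
      "(\<lambda>\<omega>. K0_hat (d T \<omega>) (n T) (G_hat T \<omega>) (thr T)) \<in> measurable (M T) (count_space UNIV)"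
      by (intro K0_hat_measurable d_meas hac hac_measurable that)
    show ?thesis by measurable
  qed

  have fin_G: "finite (G T k)" "G T k \<noteq> {}" "G T k \<subseteq> {1..n T}" if "T \<ge> 1" "k \<in> {1..K0}" for T k
    using groups_union[OF that(1)] groups_nonempty[OF that] that(2)
    by (auto intro!: finite_subset[of "G T k" "{1..n T}"])
  have G_inter: "G T k \<inter> G T k' = {}" if "T \<ge> 1" "k \<in> {1..K0}" "k' \<in> {1..K0}" "k \<noteq> k'" for T k k'
    using groups_disjoint[OF that(1)] that(2-4) by (auto simp: disjoint_family_on_def)
  \<comment> \<open>Injectivity makes the number of blocks of the true partition equal to
    \<open>K0\<close>.\<close>
  have G_inj: "inj_on (G T) {1..K0}" if "T \<ge> 1" for T
  proof (rule inj_onI, rule ccontr)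
    fix k k' assume "k \<in> {1..K0}" "k' \<in> {1..K0}" "G T k = G T k'" "k \<noteq> k'"
    then show False
      using G_inter[of T k k'] fin_G(2)[of T k] that by simp
  qed
  have G_part: "partition_on {1..n T} (G T ` {1..K0})" if "T \<ge> 1" for T
  proof (rule partition_onI)
    show "\<Union> (G T ` {1..K0}) = {1..n T}"
      using groups_union[OF that] by simp
    show "{} \<notin> G T ` {1..K0}"
      using fin_G(2)[OF that] by (metis imageE)
    fix p q assume "p \<in> G T ` {1..K0}" "q \<in> G T ` {1..K0}" "p \<noteq> q"
    then obtain k k' where "k \<in> {1..K0}" "p = G T k" "k' \<in> {1..K0}" "q = G T k'"
      by blast
    with \<open>p \<noteq> q\<close> show "disjnt p q"
      using G_inter[OF that, of k k'] by (cases "k = k'") (simp_all add: disjnt_def)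
  qed
  \<comment> \<open>The deterministic core, for a single outcome. The between-group bound is
    requested only for \<open>K0 \<ge> 2\<close>, since otherwise the minimum ranges over an empty
    set.\<close>
  have K0_hat_eq: "K0_hat (d T \<omega>) (n T) (G_hat T \<omega>) (thr T) = K0"
    if T: "T \<ge> 1" and \<omega>: "\<omega> \<in> space (M T)" and W: "?W T \<omega> \<le> thr T"
      and B: "K0 \<ge> 2 \<Longrightarrow> thr T < (MIN (k, k')\<in>?I. MIN (i, j)\<in>G T k \<times> G T k'. d T \<omega> i j)"
    for T \<omega>
  proof -
    have near: "d T \<omega> i j \<le> thr T" if "k \<in> {1..K0}" "i \<in> G T k" "j \<in> G T k" for k i j
    proof -
      have "d T \<omega> i j \<le> (MAX (i, j)\<in>G T k \<times> G T k. d T \<omega> i j)"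
        using that fin_G(1)[OF T that(1)] by (intro Max_ge image_eqI[of _ _ "(i, j)"]) auto
      also have "\<dots> \<le> ?W T \<omega>"
        using that by (intro Max_ge image_eqI[of _ _ k]) auto
      finally show ?thesis using W by simp
    qed
    have far_less: "thr T < d T \<omega> i j"
      if "k \<in> {1..K0}" "k' \<in> {1..K0}" "k < k'" "i \<in> G T k" "j \<in> G T k'" for k k' i j
    proof -
      have "finite ?I"
        by (rule finite_subset[of _ "{1..K0} \<times> {1..K0}"]) auto
      have "thr T < (MIN (k, k')\<in>?I. MIN (i, j)\<in>G T k \<times> G T k'. d T \<omega> i j)"
        using that by (intro B) auto
      also have "\<dots> \<le> (MIN (i, j)\<in>G T k \<times> G T k'. d T \<omega> i j)"
        using that \<open>finite ?I\<close> by (intro Min_le image_eqI[of _ _ "(k, k')"] finite_imageI) auto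
      also have "\<dots> \<le> d T \<omega> i j"
        using that fin_G(1)[OF T] by (intro Min_le image_eqI[of _ _ "(i, j)"]) auto
      finally show ?thesis .
    qed
    \<comment> \<open>The minimum covers only ordered labels \<open>k < k'\<close>; symmetry of the
      statistic yields the other order.\<close>
    have far: "thr T < d T \<omega> i j"
      if "k \<in> {1..K0}" "k' \<in> {1..K0}" "k \<noteq> k'" "i \<in> G T k" "j \<in> G T k'" for k k' i j
      using that far_less[of k k' i j] far_less[of k' k j i] d_commute[of T \<omega> i j]
      by (cases "k < k'") auto
    have "separates (d T \<omega>) (G T ` {1..K0}) (thr T)"
      unfolding separates_def
    proof (intro ballI)
      fix A B i j assume "A \<in> G T ` {1..K0}" "B \<in> G T ` {1..K0}" and ij: "i \<in> A" "j \<in> B"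
      then obtain k k' where "k \<in> {1..K0}" "A = G T k" "k' \<in> {1..K0}" "B = G T k'"
        by blast
      with ij show "d T \<omega> i j \<le> thr T \<longleftrightarrow> A = B"
        using near[of k i j] far[of k k' i j] by (cases "A = B") (auto simp: not_le)
    qed
    then show ?thesis
      using K0_hat_eq_card[OF hac[OF T \<omega>] G_part[OF T]] n_ge_2[OF T] card_image[OF G_inj[OF T]]
      by simp
  qed

  have W_lim: "(\<lambda>T. measure (M T) {\<omega> \<in> space (M T). \<bar>?W T \<omega>\<bar> > thr T}) \<longlonglongrightarrow> 0"
    by (rule bigO_p_tendsto_0[OF within thr_lower thr_pos prob])
  have W_meas: "\<forall>\<^sub>F T in sequentially. ?W T \<in> borel_measurable (M T)"
    using within by (simp add: bigO_p_def)

  \<comment> \<open>With fewer than two groups \<open>between\<close> provides no remainder; the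
    zero remainder then lets both cases share the rest of the argument.\<close>
  obtain R where R: "smallo_p M R ?s"
    and R_le: "\<forall>\<^sub>F T in sequentially. K0 \<ge> 2 \<longrightarrow> (\<forall>\<omega>\<in>space (M T).
      (MIN (k, k')\<in>?I. MIN (i, j)\<in>G T k \<times> G T k'. d T \<omega> i j) \<ge> c0 * ?s T + R T \<omega>)"
  proof (cases "K0 \<ge> 2")
    case True
    then show ?thesis
      using between that by (auto elim: eventually_mono)
  next
    case False
    have "smallo_p M (\<lambda>_ _. 0) ?s"
      by (simp add: smallo_p_def mult_less_0_iff)
    with False that show ?thesis by simp
  qed
  let ?q = "\<lambda>T. measure (M T) {\<omega> \<in> space (M T). \<bar>R T \<omega>\<bar> > c0 / 2 * \<bar>?s T\<bar>}"
  have R_lim: "?q \<longlonglongrightarrow> 0"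
    using R[unfolded smallo_p_def, THEN conjunct2, rule_format, OF half_gt_zero[OF c0]] .
  have R_meas: "\<forall>\<^sub>F T in sequentially. R T \<in> borel_measurable (M T)"
    using R by (simp add: smallo_p_def)
  \<comment> \<open>In HOL \<open>sqrt\<close> is negative at negative arguments, so the sign of
    \<open>h_max T\<close> has to come from the lower bound on \<open>h_min T\<close>.\<close>
  have s_nonneg: "?s T \<ge> 0" if T: "T \<ge> 1" for T
  proof -
    obtain \<delta> c where "c > 0" "h_min T \<ge> c * real T powr (- (1 - \<delta>))" "h_min T \<le> h_max T"
      using grid T unfolding location_scale_grid_def by blast
    moreover from \<open>c > 0\<close> have "c * real T powr (- (1 - \<delta>)) \<ge> 0"
      by simp
    ultimately have "h_max T \<ge> 0"
      by linarith
    then show ?thesis by simp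
  qed
  have thr_small: "\<forall>\<^sub>F T in sequentially. norm (thr T) \<le> c0 / 4 * norm (?s T)"
    using c0 by (intro landau_o.smallD[OF thr_upper]) simp

  let ?p = "\<lambda>T. measure (M T) {\<omega> \<in> space (M T). \<bar>?W T \<omega>\<bar> > thr T}"
  have lower: "\<forall>\<^sub>F T in sequentially. 1 - (?p T + ?q T) \<le> measure (M T) (?E T)"
    using eventually_ge_at_top[of 1] W_meas R_meas R_le thr_small thr_pos
  proof eventually_elim
    case (elim T)
    interpret prob_space "M T"
      using elim(1) by (rule prob_space_M)
    note [measurable] = elim(2,3)
    let ?A = "{\<omega> \<in> space (M T). \<bar>?W T \<omega>\<bar> > thr T}"
    let ?B = "{\<omega> \<in> space (M T). \<bar>R T \<omega>\<bar> > c0 / 2 * \<bar>?s T\<bar>}"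
    have AB: "?A \<in> sets (M T)" "?B \<in> sets (M T)"
      by measurable
    \<comment> \<open>Positivity of \<open>thr T\<close> rules out \<open>?s T = 0\<close>, so the
      bound with \<open>c0 / 4\<close> becomes strict with \<open>c0 / 2\<close>.\<close>
    have thr_lt: "thr T < c0 / 2 * \<bar>?s T\<bar>"
      using elim(5,6) by simp
    \<comment> \<open>Off the two bad events the remainder consumes at most half of the signal
      \<open>c0 * ?s T\<close>, and the other half still exceeds the threshold.\<close>
    have good: "\<omega> \<in> ?E T" if \<omega>: "\<omega> \<in> space (M T) - (?A \<union> ?B)" for \<omega>
    proof -
      have "\<bar>R T \<omega>\<bar> \<le> c0 / 2 * \<bar>?s T\<bar>" "\<bar>?W T \<omega>\<bar> \<le> thr T" "\<omega> \<in> space (M T)"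
        using \<omega> by (simp_all add: not_less)
      then have "thr T < c0 * ?s T + R T \<omega>" "?W T \<omega> \<le> thr T"
        using thr_lt s_nonneg[OF elim(1)] by linarith+
      then have "K0_hat (d T \<omega>) (n T) (G_hat T \<omega>) (thr T) = K0"
        using elim(4) \<open>\<omega> \<in> space (M T)\<close>
        by (intro K0_hat_eq[OF elim(1)]) (blast intro: less_le_trans)+
      with that show ?thesis by simp
    qed
    have "1 - prob (?A \<union> ?B) = prob (space (M T) - (?A \<union> ?B))"
      using AB by (intro prob_compl[symmetric] sets.Un)
    also have "\<dots> \<le> prob (?E T)"
      using good E_sets[OF elim(1)] by (intro finite_measure_mono subsetI)
    finally have "1 - prob (?A \<union> ?B) \<le> prob (?E T)" .
    moreover have "prob (?A \<union> ?B) \<le> prob ?A + prob ?B"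
      using AB by (intro measure_Un_le)
    ultimately show ?case by linarith
  qed
  have upper: "\<forall>\<^sub>F T in sequentially. measure (M T) (?E T) \<le> 1"
    using prob by eventually_elim (rule prob_space.prob_le_1)
  have "(\<lambda>T. 1 - (?p T + ?q T)) \<longlonglongrightarrow> 1 - (0 + 0)"
    by (intro tendsto_intros W_lim R_lim)
  then show ?thesis
    by (intro tendsto_sandwich[OF lower upper]) simp_all
qed

end
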